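(* Let $q>0$ be real with $q\ne1$. For every positive integer $n$, the $q$-difference equation $$D_{q,x}^2y(x)-2x\,D_{q,x}y(x)+2[n]_q\,y(x)=0$$ has a polynomial solution $y_{H,m_q}(x)=\sum_{\nu=0}^na_\nu x^\nu$ given by: (1) If $n$ is even, $a_0\ne0$ is arbitrary, $a_{2k-1}=0$ for $1\le k\le n/2$, $a_2=-\frac{2[n]_q}{[2]_q}a_0$, and for $k\ge2$ (with $2k\le n$) $$a_{2k}=-\frac{2[n]_q}{[2]_q}a_0\prod_{j=1}^{k-1}\frac{2[2j]_q-2[n]_q}{[2j+2]_q[2j+1]_q}.$$ (2) If $n$ is odd, $a_1\ne0$ is arbitrary, $a_{2k}=0$ for $0\le k\le\lfloor n/2\rfloor$, and for $k\ge1$ (with $2k+1\le n$) $$a_{2k+1}=a_1\prod_{j=0}^{k-1}\frac{2[2j+1]_q-2[n]_q}{[2j+3]_q[2j+2]_q}.$$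
   Context: $[j]_q=\frac{1-q^j}{1-q}$ for integers $j\ge0$. $D_{q,x}$ is the Jackson $q$-derivative $D_{q,x}f(x)=\frac{f(qx)-f(x)}{qx-x}$, which acts on polynomials by $D_{q,x}1=0$, $D_{q,x}x^k=[k]_qx^{k-1}$ for $k\ge1$; $D_{q,x}^2=D_{q,x}\circ D_{q,x}$. *)

theory Defs
  imports Complex_Main "HOL-Computational_Algebra.Polynomial"
begin

definition qnum :: "real \<Rightarrow> nat \<Rightarrow> real" where
  "qnum q j = (1 - q ^ j) / (1 - q)"

definition jackson :: "real \<Rightarrow> (real \<Rightarrow> real) \<Rightarrow> real \<Rightarrow> real" where
  "jackson q f x = (f (q * x) - f x) / (q * x - x)"

text \<open>
  On functions the Jackson quotient is of the form 0/0 at the origin, so the operator is taken on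
  polynomials, as the quotient of \<open>p(qx) - p(x)\<close> by \<open>qx - x\<close> in the polynomial ring.
  The division is exact for every \<open>q \<noteq> 1\<close>; the lemmas below give the action on powers and the
  agreement with the quotient of functions away from the origin.
\<close>

definition qderiv :: "real \<Rightarrow> real poly \<Rightarrow> real poly" where
  "qderiv q p = (pcompose p [:0, q:] - p) div [:0, q - 1:]"

lemma qderiv_exact:
  assumes "q \<noteq> 1"
  shows "[:0, q - 1:] * qderiv q p = pcompose p [:0, q:] - p"
proof -
  let ?r = "pcompose p [:0, q:] - p"
  have "poly ?r 0 = 0"
    by (simp add: poly_pcompose)
  then have "[:0, 1:] dvd ?r"
    using poly_eq_0_iff_dvd[of ?r 0] by simp
  then have "smult (q - 1) [:0, 1:] dvd ?r"
    using assms by (subst smult_dvd_iff) simp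
  then have "[:0, q - 1:] dvd ?r"
    by simp
  then show ?thesis
    unfolding qderiv_def by (rule dvd_mult_div_cancel)
qed

lemma coeff_qderiv:
  assumes "q \<noteq> 1"
  shows "coeff (qderiv q p) k = qnum q (Suc k) * coeff p (Suc k)"
proof -
  have "(q - 1) * coeff (qderiv q p) k = coeff ([:0, q - 1:] * qderiv q p) (Suc k)"
    by simp
  also have "\<dots> = (q ^ Suc k - 1) * coeff p (Suc k)"
    unfolding qderiv_exact[OF assms] by (simp add: coeff_pcompose_linear algebra_simps)
  finally show ?thesis
    using assms by (simp add: qnum_def divide_simps) (simp add: algebra_simps)
qed

lemma qderiv_one: "q \<noteq> 1 \<Longrightarrow> qderiv q 1 = 0"
  by (rule poly_eqI) (simp add: coeff_qderiv)

lemma qderiv_power: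
  assumes "q \<noteq> 1" "k \<ge> 1"
  shows "qderiv q (monom 1 k) = smult (qnum q k) (monom 1 (k - 1))"
  using assms by (intro poly_eqI) (auto simp: coeff_qderiv)

lemma poly_qderiv:
  assumes "q \<noteq> 1" "x \<noteq> 0"
  shows "poly (qderiv q p) x = jackson q (poly p) x"
proof -
  have "poly ([:0, q - 1:] * qderiv q p) x = poly p (q * x) - poly p x"
    unfolding qderiv_exact[OF assms(1)] by (simp add: poly_pcompose mult.commute)
  then have "(q * x - x) * poly (qderiv q p) x = poly p (q * x) - poly p x"
    by (simp add: algebra_simps)
  moreover have "q * x - x \<noteq> 0"
    using assms by simp
  ultimately show ?thesis
    by (simp add: jackson_def nonzero_eq_divide_eq mult.commute)
qed

lemma poly_qderiv_qderiv:
  assumes "q \<noteq> 0" "q \<noteq> 1" "x \<noteq> 0"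
  shows "poly (qderiv q (qderiv q p)) x = jackson q (jackson q (poly p)) x"
  using assms by (simp add: poly_qderiv jackson_def[of q "poly (qderiv q p)"]
      jackson_def[of q "jackson q (poly p)"])

definition solves_q_hermite :: "real \<Rightarrow> nat \<Rightarrow> real poly \<Rightarrow> bool" where
  "solves_q_hermite q n y \<longleftrightarrow>
     qderiv q (qderiv q y) - smult 2 ([:0, 1:] * qderiv q y) + smult (2 * qnum q n) y = 0"

end

theory Submission imports Defs
begin

text \<open>
  Comparing coefficients turns the equation into a two-term recurrence from \<open>a\<^sub>k\<close> to \<open>a\<^sub>k\<^sub>+\<^sub>2\<close>
  whose factor \<open>2[k] - 2[n]\<close> vanishes at \<open>k = n\<close>. A solution supported on the indices of the
  parity of \<open>n\<close> therefore terminates in degree \<open>n\<close>.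
\<close>

lemma qnum_zero [simp]: "qnum q 0 = 0"
  by (simp add: qnum_def)

lemma qnum_one: "q \<noteq> 1 \<Longrightarrow> qnum q (Suc 0) = 1"
  by (simp add: qnum_def)

text \<open>A positive real other than 1 is not a root of unity. This is what permits solving the
  coefficient recurrence for \<open>a (k + 2)\<close> by division.\<close>

lemma qnum_nonzero:
  assumes "q > 0" "q \<noteq> 1" "j > 0"
  shows "qnum q j \<noteq> 0"
proof -
  have "q ^ j \<noteq> 1"
    using power_eq_imp_eq_base[of q j 1] assms by auto
  then show ?thesis
    using assms by (simp add: qnum_def)
qed

lemma solves_q_hermite_iff_coeff:
  assumes "q \<noteq> 1"
  shows "solves_q_hermite q n y \<longleftrightarrow>
    (\<forall>k. qnum q (k + 1) * qnum q (k + 2) * coeff y (k + 2) =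
         (2 * qnum q k - 2 * qnum q n) * coeff y k)"
proof -
  have "coeff (qderiv q (qderiv q y) - smult 2 ([:0, 1:] * qderiv q y)
          + smult (2 * qnum q n) y) k =
        qnum q (k + 1) * qnum q (k + 2) * coeff y (k + 2) -
          (2 * qnum q k - 2 * qnum q n) * coeff y k" for k
    \<comment> \<open>Multiplication by \<open>[:0, 1:]\<close> shifts the derivative back, giving
      \<open>qnum q k * coeff y k\<close>. At \<open>k = 0\<close> this product has no constant
      term, in agreement with \<open>qnum q 0 = 0\<close>.\<close>
    using assms by (cases k) (simp_all add: coeff_qderiv algebra_simps)
  then show ?thesis
    unfolding solves_q_hermite_def poly_eq_iff by simp
qed

text \<open>The sequence \<open>a\<close> obeys the recurrence at every index, so only the
  truncation at \<open>n\<close> needs care: it could break the coefficient identity only where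
  \<open>k \<le> n < k + 2\<close>.\<close>

lemma solves_q_hermite_sum:
  assumes "q > 0" "q \<noteq> 1"
    and rec: "\<And>k. a (k + 2) =
      (2 * qnum q k - 2 * qnum q n) / (qnum q (k + 2) * qnum q (k + 1)) * a k"
    and parity: "\<And>k. odd (k + n) \<Longrightarrow> a k = 0"
  shows "solves_q_hermite q n (\<Sum>\<nu> = 0..n. monom (a \<nu>) \<nu>)"
proof -
  have coeff: "coeff (\<Sum>\<nu> = 0..n. monom (a \<nu>) \<nu>) k = (if k \<le> n then a k else 0)" for k
    by (simp add: coeff_sum)
  have "qnum q (k + 1) * qnum q (k + 2) * (if k + 2 \<le> n then a (k + 2) else 0) =
        (2 * qnum q k - 2 * qnum q n) * (if k \<le> n then a k else 0)" for k
  proof -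
    \<comment> \<open>Below the cut the recurrence applies. At \<open>k = n - 1\<close> the
      right-hand factor need not vanish, so parity must give \<open>a k = 0\<close>; at
      \<open>k = n\<close> the factor itself is zero; beyond \<open>n\<close> both sides are
      zero.\<close>
    consider "k + 2 \<le> n" | "n = k + 1" | "n = k" | "k > n"
      by linarith
    then show ?thesis
    proof cases
      case 1
      then show ?thesis
        using qnum_nonzero[OF assms(1,2), of "k + 1"] qnum_nonzero[OF assms(1,2), of "k + 2"]
        by (simp add: rec[of k, simplified])
    next
      case 2
      then show ?thesis
        using parity[of k] by simp
    qed simp_all
  qed
  then show ?thesis
    unfolding solves_q_hermite_iff_coeff[OF assms(2)] coeff by blast
qed

text \<open>One formula serves both parities: \<open>n mod 2\<close> is the index of the free
  coefficient \<open>c\<close>, and \<open>\<nu> div 2\<close> counts the recurrence steps leading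
  from it to \<open>\<nu>\<close>.\<close>

definition q_hermite_coeff :: "real \<Rightarrow> nat \<Rightarrow> real \<Rightarrow> nat \<Rightarrow> real" where
  "q_hermite_coeff q n c \<nu> =
    (if even (\<nu> + n)
     then c * (\<Prod>j<\<nu> div 2. (2 * qnum q (2 * j + n mod 2) - 2 * qnum q n) /
                 (qnum q (2 * j + n mod 2 + 2) * qnum q (2 * j + n mod 2 + 1)))
     else 0)"

text \<open>Passing from \<open>k\<close> to \<open>k + 2\<close> appends the factor with
  \<open>j = k div 2\<close>, whose index \<open>2 * j + n mod 2\<close> equals \<open>k\<close>
  when the parities agree. Otherwise both coefficients are zero.\<close>

lemma q_hermite_coeff_rec:
  "q_hermite_coeff q n c (k + 2) =
    (2 * qnum q k - 2 * qnum q n) / (qnum q (k + 2) * qnum q (k + 1)) * q_hermite_coeff q n c k"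
proof (cases "even (k + n)")
  case True
  then have "2 * (k div 2) + n mod 2 = k"
    by presburger
  then show ?thesis
    using True by (simp add: q_hermite_coeff_def)
qed (simp add: q_hermite_coeff_def)

lemma solves_q_hermite_q_hermite_coeff:
  assumes "q > 0" "q \<noteq> 1"
  shows "solves_q_hermite q n (\<Sum>\<nu> = 0..n. monom (q_hermite_coeff q n c \<nu>) \<nu>)"
  using assms by (rule solves_q_hermite_sum[OF _ _ q_hermite_coeff_rec])
    (simp add: q_hermite_coeff_def)

theorem corollary6:
  fixes q :: real and n :: nat
  assumes "q > 0" and "q \<noteq> 1" and "n \<ge> 1"
  shows
    "(even n \<longrightarrow>
       (\<forall>c::real. c \<noteq> 0 \<longrightarrow>
         (\<exists>a :: nat \<Rightarrow> real.
            a 0 = c \<and>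
            (\<forall>k. 1 \<le> k \<and> k \<le> n div 2 \<longrightarrow> a (2 * k - 1) = 0) \<and>
            a 2 = - (2 * qnum q n / qnum q 2) * a 0 \<and>
            (\<forall>k. 2 \<le> k \<and> 2 * k \<le> n \<longrightarrow>
               a (2 * k) = - (2 * qnum q n / qnum q 2) * a 0 *
                 (\<Prod>j = 1..k - 1. (2 * qnum q (2 * j) - 2 * qnum q n) /
                                  (qnum q (2 * j + 2) * qnum q (2 * j + 1)))) \<and>
            solves_q_hermite q n (\<Sum>\<nu> = 0..n. monom (a \<nu>) \<nu>)))) \<and>
     (odd n \<longrightarrow>
       (\<forall>c::real. c \<noteq> 0 \<longrightarrow>
         (\<exists>a :: nat \<Rightarrow> real.
            a 1 = c \<and>
            (\<forall>k. k \<le> n div 2 \<longrightarrow> a (2 * k) = 0) \<and>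
            (\<forall>k. 1 \<le> k \<and> 2 * k + 1 \<le> n \<longrightarrow>
               a (2 * k + 1) = a 1 *
                 (\<Prod>j = 0..k - 1. (2 * qnum q (2 * j + 1) - 2 * qnum q n) /
                                  (qnum q (2 * j + 3) * qnum q (2 * j + 2)))) \<and>
            solves_q_hermite q n (\<Sum>\<nu> = 0..n. monom (a \<nu>) \<nu>))))"
proof (intro conjI impI allI)
  fix c :: real
  assume n: "even n"
  let ?a = "q_hermite_coeff q n c"
  let ?h = "\<lambda>j. (2 * qnum q (2 * j) - 2 * qnum q n) / (qnum q (2 * j + 2) * qnum q (2 * j + 1))"
  have even_coeff: "?a (2 * k) = c * (\<Prod>j<k. ?h j)" for k
    using n by (simp add: q_hermite_coeff_def)
  \<comment> \<open>The factor at \<open>j = 0\<close> collapses because \<open>qnum q 0 = 0\<close>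
    and \<open>qnum q 1 = 1\<close>. It is the ratio of \<open>a 2\<close> to \<open>a 0\<close>,
    which the stated formula writes in front of a product starting at \<open>j = 1\<close>.\<close>
  have h0: "?h 0 = - (2 * qnum q n / qnum q 2)"
    using qnum_one[OF assms(2)] by (simp add: numeral_2_eq_2)
  have a0: "?a 0 = c"
    using even_coeff[of 0] by simp
  \<comment> \<open>The bound \<open>1 \<le> k\<close> keeps the natural subtraction from
    truncating, so the index is odd.\<close>
  moreover have "?a (2 * k - 1) = 0" if "1 \<le> k \<and> k \<le> n div 2" for k
    using n that by (simp add: q_hermite_coeff_def)
  moreover have "?a 2 = - (2 * qnum q n / qnum q 2) * ?a 0"
  proof -
    have "?a 2 = c * ?h 0"
      using even_coeff[of 1] by simp
    then show ?thesis
      unfolding h0 a0 by simp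
  qed
  moreover have "?a (2 * k) = - (2 * qnum q n / qnum q 2) * ?a 0 * (\<Prod>j = 1..k - 1. ?h j)"
    if "2 \<le> k \<and> 2 * k \<le> n" for k
  proof -
    have "{..<k} = insert 0 {1..k - 1}"
      using that by auto
    then have "(\<Prod>j<k. ?h j) = ?h 0 * (\<Prod>j = 1..k - 1. ?h j)"
      by simp
    then show ?thesis
      unfolding even_coeff a0 h0 by (simp add: mult_ac)
  qed
  ultimately show "\<exists>a. a 0 = c \<and>
      (\<forall>k. 1 \<le> k \<and> k \<le> n div 2 \<longrightarrow> a (2 * k - 1) = 0) \<and>
      a 2 = - (2 * qnum q n / qnum q 2) * a 0 \<and>
      (\<forall>k. 2 \<le> k \<and> 2 * k \<le> n \<longrightarrow>
        a (2 * k) = - (2 * qnum q n / qnum q 2) * a 0 * (\<Prod>j = 1..k - 1. ?h j)) \<and>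
      solves_q_hermite q n (\<Sum>\<nu> = 0..n. monom (a \<nu>) \<nu>)"
    using solves_q_hermite_q_hermite_coeff[OF assms(1,2)] by blast
next
  fix c :: real
  assume n: "odd n"
  let ?a = "q_hermite_coeff q n c"
  let ?h = "\<lambda>j. (2 * qnum q (2 * j + 1) - 2 * qnum q n) /
    (qnum q (2 * j + 3) * qnum q (2 * j + 2))"
  have "n mod 2 = 1"
    using n by presburger
  then have odd_coeff: "?a (2 * k + 1) = c * (\<Prod>j<k. ?h j)" for k
    using n by (simp add: q_hermite_coeff_def numeral_3_eq_3)
  have a1: "?a 1 = c"
    using odd_coeff[of 0] by simp
  moreover have "?a (2 * k) = 0" if "k \<le> n div 2" for k
    using n by (simp add: q_hermite_coeff_def)
  moreover have "?a (2 * k + 1) = ?a 1 * (\<Prod>j = 0..k - 1. ?h j)"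
    if "1 \<le> k \<and> 2 * k + 1 \<le> n" for k
  proof -
    \<comment> \<open>This needs \<open>k \<ge> 1\<close>: at \<open>k = 0\<close> the right side
      would be the singleton of 0 instead of the empty set.\<close>
    have "{..<k} = {0..k - 1}"
      using that by auto
    then show ?thesis
      unfolding odd_coeff a1 by simp
  qed
  ultimately show "\<exists>a. a 1 = c \<and>
      (\<forall>k. k \<le> n div 2 \<longrightarrow> a (2 * k) = 0) \<and>
      (\<forall>k. 1 \<le> k \<and> 2 * k + 1 \<le> n \<longrightarrow> a (2 * k + 1) = a 1 * (\<Prod>j = 0..k - 1. ?h j)) \<and>
      solves_q_hermite q n (\<Sum>\<nu> = 0..n. monom (a \<nu>) \<nu>)"
    using solves_q_hermite_q_hermite_coeff[OF assms(1,2)] by blast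
qed

end
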